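(* Let $n\geq 1$ and $|T|\ge 1$, and write $|T|=qn+s$ with integers $q\ge0$ and $0\le s<n$. Serial dictatorship is an online rule that satisfies all-rank-PJR with additive loss $\lfloor s(n-s)/n\rfloor$. No smaller additive loss is possible for all profiles with $n$ voters and horizon $|T|$, even for an offline rule and all-rank-wPJR. The lower bound holds on a static profile with $m=n$ candidates: there is a static profile with $n$ voters, $n$ candidates and horizon $|T|$ for which no sequence satisfies all-rank-wPJR with additive loss $L$ for any integer $0\le L<\lfloor s(n-s)/n\rfloor$.
   Context: Model. Voters $V=[n]$, a set $C$ of $m$ candidates, rounds $T=\{1,\dots,|T|\}$; $|T|$ is the horizon. In each round $j$ each voter $i$ has a strict complete ranking of $C$; a profile consists of all rankings and is static if they are the same in all rounds. For $r\in[m]$, $A_i^j(r)$ is the set of voter $i$'s $r$ most-preferred candidates in round $j$. A sequence is $W=(w^1,\dots,w^{|T|})\in C^{|T|}$. A group is a nonempty $S\subseteq V$. A rule is offline if it may use the whole profile; online if each $w^j$ depends only on the rankings in rounds $1,\dots,j$ and not on $|T|$. All-rank axioms. A rank matrix is $R=(r_i^j)\in[m]^{|T|\times n}$. Under $R$, a group $S$ agrees in round $j$ if $\bigcap_{i\in S}A_i^j(r_i^j)\ne\varnothing$, and is represented in round $j$ if $w^j\in\bigcup_{i\in S}A_i^j(r_i^j)$. For an integer $L\ge0$, $W$ satisfies all-rank-PJR with additive loss $L$ if, for every rank matrix $R$, every group $S$ that agrees in $k>0$ rounds under $R$ is represented in at least $\lfloor k|S|/n\rfloor-L$ rounds. All-rank-wPJR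 with additive loss $L$ is this requirement restricted to groups that agree in every round ($k=|T|$). Serial dictatorship: cycle through the voters in a fixed order and, in each round, select the current voter's first choice (most-preferred candidate in that round). *)

theory Defs
  imports Complex_Main "HOL-Library.FuncSet" "HOL-Combinatorics.Multiset_Permutations"
begin

text \<open>
  Voters are \<open>{1..n}\<close> and rounds are \<open>{1..T}\<close>. A strict complete ranking of the
  candidate set \<open>C\<close> is a list enumerating \<open>C\<close> without repetition, most preferred
  candidate first; \<open>P j i\<close> is the ranking of voter \<open>i\<close> in round \<open>j\<close>. The extensional
  function space makes a profile carry exactly the rankings of rounds \<open>1, \<dots>, T\<close>, so a
  function of the profile cannot use anything else.
\<close>

type_synonym 'c profile = "nat \<Rightarrow> nat \<Rightarrow> 'c list"

definition profiles :: "nat \<Rightarrow> 'c set \<Rightarrow> nat \<Rightarrow> 'c profile set" where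
  "profiles n C T = {1..T} \<rightarrow>\<^sub>E ({1..n} \<rightarrow>\<^sub>E permutations_of_set C)"

definition static_profile :: "nat \<Rightarrow> 'c profile \<Rightarrow> bool" where
  "static_profile T P \<longleftrightarrow> (\<forall>j\<in>{1..T}. \<forall>j'\<in>{1..T}. P j = P j')"

definition sequences :: "'c set \<Rightarrow> nat \<Rightarrow> (nat \<Rightarrow> 'c) set" where
  "sequences C T = {1..T} \<rightarrow>\<^sub>E C"

definition top_choices :: "'c profile \<Rightarrow> nat \<Rightarrow> nat \<Rightarrow> nat \<Rightarrow> 'c set" where
  "top_choices P j i r = set (take r (P j i))"


type_synonym rank_matrix = "nat \<Rightarrow> nat \<Rightarrow> nat"

definition rank_matrices :: "nat \<Rightarrow> 'c set \<Rightarrow> nat \<Rightarrow> rank_matrix set" where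
  "rank_matrices n C T = {1..T} \<rightarrow>\<^sub>E ({1..n} \<rightarrow>\<^sub>E {1..card C})"

definition group :: "nat \<Rightarrow> nat set \<Rightarrow> bool" where
  "group n S \<longleftrightarrow> S \<noteq> {} \<and> S \<subseteq> {1..n}"

definition agrees :: "'c profile \<Rightarrow> rank_matrix \<Rightarrow> nat set \<Rightarrow> nat \<Rightarrow> bool" where
  "agrees P R S j \<longleftrightarrow> (\<Inter>i\<in>S. top_choices P j i (R j i)) \<noteq> {}"

definition represented ::
  "'c profile \<Rightarrow> rank_matrix \<Rightarrow> (nat \<Rightarrow> 'c) \<Rightarrow> nat set \<Rightarrow> nat \<Rightarrow> bool" where
  "represented P R W S j \<longleftrightarrow> W j \<in> (\<Union>i\<in>S. top_choices P j i (R j i))"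

definition all_rank_PJR ::
  "nat \<Rightarrow> 'c set \<Rightarrow> nat \<Rightarrow> 'c profile \<Rightarrow> (nat \<Rightarrow> 'c) \<Rightarrow> int \<Rightarrow> bool" where
  "all_rank_PJR n C T P W L \<longleftrightarrow>
     (\<forall>R\<in>rank_matrices n C T. \<forall>S k.
        group n S \<and> k = card {j\<in>{1..T}. agrees P R S j} \<and> k > 0 \<longrightarrow>
        int (card {j\<in>{1..T}. represented P R W S j})
          \<ge> \<lfloor>real k * real (card S) / real n\<rfloor> - L)"

definition all_rank_wPJR ::
  "nat \<Rightarrow> 'c set \<Rightarrow> nat \<Rightarrow> 'c profile \<Rightarrow> (nat \<Rightarrow> 'c) \<Rightarrow> int \<Rightarrow> bool" where
  "all_rank_wPJR n C T P W L \<longleftrightarrow>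
     (\<forall>R\<in>rank_matrices n C T. \<forall>S.
        group n S \<and> (\<forall>j\<in>{1..T}. agrees P R S j) \<longrightarrow>
        int (card {j\<in>{1..T}. represented P R W S j})
          \<ge> \<lfloor>real T * real (card S) / real n\<rfloor> - L)"


text \<open>A rule maps a horizon and a profile with that horizon to a sequence.\<close>

type_synonym 'c rule = "nat \<Rightarrow> 'c profile \<Rightarrow> nat \<Rightarrow> 'c"

definition offline_rule :: "nat \<Rightarrow> 'c set \<Rightarrow> 'c rule \<Rightarrow> bool" where
  "offline_rule n C F \<longleftrightarrow> (\<forall>T. \<forall>P\<in>profiles n C T. F T P \<in> sequences C T)"

text \<open>
  The two profiles compared may have different horizons: the choice in round \<open>j\<close> is
  determined by the rankings up to round \<open>j\<close> and does not depend on the horizon.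
\<close>

definition online_rule :: "nat \<Rightarrow> 'c set \<Rightarrow> 'c rule \<Rightarrow> bool" where
  "online_rule n C F \<longleftrightarrow> offline_rule n C F \<and>
     (\<forall>T T'. \<forall>P\<in>profiles n C T. \<forall>P'\<in>profiles n C T'. \<forall>j\<in>{1..T} \<inter> {1..T'}.
        (\<forall>l\<in>{1..j}. P l = P' l) \<longrightarrow> F T P j = F T' P' j)"

text \<open>The list \<open>vs\<close> enumerates the voters in the order in which they are cycled through.\<close>

definition serial_dictatorship :: "nat list \<Rightarrow> 'c rule" where
  "serial_dictatorship vs T P = (\<lambda>j\<in>{1..T}. hd (P j (vs ! ((j - 1) mod length vs))))"

end

theory Submission
  imports Defs
begin

text \<open>
  Upper bound: whenever the dictator of a round belongs to \<open>S\<close>, the group \<open>S\<close> is represented, and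
  of the \<open>s\<close> dictators in the incomplete last cycle at least \<open>card S + s - n\<close> belong to \<open>S\<close>.

  Lower bound: in the cyclic profile voter \<open>i\<close> ranks \<open>i, i + 1, \<dots>, n, 1, \<dots>, i - 1\<close>. If \<open>w \<notin> S\<close>, then
  every voter in \<open>S\<close> prefers the cyclic predecessor of \<open>w\<close> to \<open>w\<close>, so \<open>S\<close> can agree in a round won
  by \<open>w\<close> without being represented. By pigeonhole some \<open>n - s\<close> candidates win at most \<open>q (n - s)\<close>
  rounds in total; the voters with the same indices form the deprived group.
\<close>

section \<open>Upper bound: counting the rounds dictated by a group\<close>

lemma sum_mod_period:
  fixes g :: "nat \<Rightarrow> 'a::comm_semiring_1"
  assumes "s \<le> n"
  shows "(\<Sum>j<q * n + s. g (j mod n)) = of_nat q * (\<Sum>j<n. g j) + (\<Sum>j<s. g j)"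
proof (induction q)
  case 0
  show ?case using assms by (auto intro!: sum.cong)
next
  case (Suc q)
  \<comment> \<open>The first complete cycle is split off; the remaining indices are shifted down by
    \<open>n\<close>, which leaves \<open>j mod n\<close> unchanged.\<close>
  have "(\<Sum>j<Suc q * n + s. g (j mod n))
      = (\<Sum>j\<in>{0..<n}. g (j mod n)) + (\<Sum>j\<in>{n..<n + (q * n + s)}. g (j mod n))"
    by (subst sum.atLeastLessThan_concat) (auto simp: atLeast0LessThan add.assoc)
  also have "(\<Sum>j\<in>{n..<n + (q * n + s)}. g (j mod n)) = (\<Sum>j<q * n + s. g (j mod n))"
    using sum.shift_bounds_nat_ivl[of "\<lambda>j. g (j mod n)" 0 n "q * n + s"]
    by (simp add: atLeast0LessThan add.commute)
  also have "(\<Sum>j\<in>{0..<n}. g (j mod n)) = (\<Sum>j<n. g j)"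
    by (auto intro!: sum.cong simp: atLeast0LessThan)
  finally show ?case using Suc.IH by (simp add: algebra_simps)
qed

text \<open>Each complete cycle meets every member of \<open>S\<close> once. The truncated
  subtraction is intended: if \<open>card S + s \<le> n\<close>, the incomplete cycle may miss
  \<open>S\<close> altogether.\<close>

lemma card_cyclic_rounds_ge:
  assumes "vs \<in> permutations_of_set {1..n}" and "S \<subseteq> {1..n}" and "s < n"
  shows "card {j \<in> {1..q * n + s}. vs ! ((j - 1) mod n) \<in> S} \<ge> q * card S + (card S + s - n)"
proof -
  have vs: "set vs = {1..n}" "distinct vs" "length vs = n"
    using assms(1) permutations_of_setD length_finite_permutations_of_set by fastforce+
  define g where "g i = (if vs ! i \<in> S then 1 else 0 :: nat)" for i
  have card_g: "(\<Sum>j\<in>A. g j) = card {j \<in> A. vs ! j \<in> S}" if "finite A" for A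
    using that by (simp add: g_def sum.If_cases Int_def)
  have "bij_betw (\<lambda>i. vs ! i) {j \<in> {..<n}. vs ! j \<in> S} S"
    using vs assms(2) by (auto simp: bij_betw_def inj_on_def nth_eq_iff_index_eq in_set_conv_nth image_iff)
      (metis in_set_conv_nth subsetD)
  then have full: "(\<Sum>j<n. g j) = card S"
    by (simp add: card_g bij_betw_same_card)
  have "(\<Sum>j<n. g j) = (\<Sum>j<s. g j) + (\<Sum>j\<in>{s..<n}. g j)"
    using assms(3) by (simp add: sum.atLeastLessThan_concat flip: atLeast0LessThan)
  \<comment> \<open>At most \<open>n - s\<close> members of \<open>S\<close> occupy positions that
    the incomplete cycle does not reach.\<close>
  moreover have "(\<Sum>j\<in>{s..<n}. g j) \<le> (\<Sum>j\<in>{s..<n}. 1)"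
    by (rule sum_mono) (simp add: g_def)
  ultimately have part: "(\<Sum>j<s. g j) \<ge> card S + s - n"
    using full assms(3) by simp
  have "(\<Sum>j<q * n + s. g (j mod n)) = card {j \<in> {..<q * n + s}. vs ! (j mod n) \<in> S}"
    by (simp add: g_def sum.If_cases Int_def)
  \<comment> \<open>Passage from list positions, counted from 0, to rounds, counted from 1.\<close>
  also have "\<dots> = card {j \<in> {1..q * n + s}. vs ! ((j - 1) mod n) \<in> S}"
    by (rule bij_betw_same_card[of Suc], rule bij_betw_byWitness[of _ "\<lambda>j. j - 1"]) auto
  finally show ?thesis
    using sum_mod_period[of s n g q] full part assms(3) by simp
qed

lemma serial_dictatorship_online:
  assumes "n \<ge> 1" and "C \<noteq> {}" and "vs \<in> permutations_of_set {1..n}"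
  shows "online_rule n C (serial_dictatorship vs)"
proof -
  have vs: "set vs = {1..n}" "length vs = n"
    using assms(3) permutations_of_setD length_finite_permutations_of_set by fastforce+
  have "hd (P j (vs ! ((j - 1) mod length vs))) \<in> C" if "P \<in> profiles n C T" "j \<in> {1..T}" for P T j
  proof -
    have "vs ! ((j - 1) mod length vs) \<in> {1..n}"
      using assms(1) vs by (metis mod_less_divisor nth_mem zero_less_one order_less_le_trans)
    then have "P j (vs ! ((j - 1) mod length vs)) \<in> permutations_of_set C"
      using that by (auto simp: profiles_def PiE_iff)
    then show ?thesis
      using assms(2) by (metis hd_in_set permutations_of_setD(1) set_empty)
  qed
  then show ?thesis
    by (auto simp: online_rule_def offline_rule_def sequences_def serial_dictatorship_def)
qed

text \<open>The shortfall \<open>s * a / n - max 0 (a + s - n)\<close> of a group of size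
  \<open>a\<close> in the incomplete cycle is greatest at \<open>a = n - s\<close>, where it equals
  \<open>s * (n - s) / n\<close>. For \<open>a + s > n\<close> the slack, multiplied by
  \<open>n\<close>, is \<open>(n - s) * (a + s - n)\<close>. The count of represented rounds is an
  integer, so it passes through the floor.\<close>

lemma partial_cycle_loss:
  fixes n s a k q :: nat
  assumes "s < n" and "k \<le> q * n + s"
  shows "\<lfloor>real k * real a / real n\<rfloor> - \<lfloor>real s * (real n - real s) / real n\<rfloor>
    \<le> int (q * a + (a + s - n))"
proof -
  have "real s * real a \<le> real n * real (a + s - n) + real s * (real n - real s)"
  proof (cases "a + s \<le> n")
    case True
    then have "real a \<le> real n - real s" by linarith
    then show ?thesis using True by (simp add: mult_left_mono)
  next
    case False
    then have "0 \<le> (real n - real s) * (real a + real s - real n)"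
      using assms(1) by (intro mult_nonneg_nonneg) auto
    then show ?thesis using False by (simp add: of_nat_diff algebra_simps)
  qed
  moreover have "real k * real a \<le> real (q * n + s) * real a"
    using assms(2) by (intro mult_right_mono) linarith+
  ultimately have "real k * real a \<le> real n * real (q * a + (a + s - n)) + real s * (real n - real s)"
    by (simp add: algebra_simps)
  then have "real k * real a / real n
      \<le> real s * (real n - real s) / real n + real_of_int (int (q * a + (a + s - n)))"
    using assms(1) by (simp add: field_simps)
  then show ?thesis
    by (metis floor_mono floor_add_int add.commute diff_le_eq)
qed

lemma serial_dictatorship_all_rank_PJR:
  assumes "finite C" and "C \<noteq> {}" and vs: "vs \<in> permutations_of_set {1..n}"
    and P: "P \<in> profiles n C (q * n + s)" and "s < n"
  shows "all_rank_PJR n C (q * n + s) P (serial_dictatorship vs (q * n + s) P)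
    \<lfloor>real s * (real n - real s) / real n\<rfloor>"
  unfolding all_rank_PJR_def
proof (intro ballI allI impI, elim conjE)
  fix R S k
  let ?T = "q * n + s"
  let ?W = "serial_dictatorship vs ?T P"
  assume R: "R \<in> rank_matrices n C ?T" and "group n S"
    and k: "k = card {j \<in> {1..?T}. agrees P R S j}"
  then have S: "S \<subseteq> {1..n}" by (simp add: group_def)
  have len: "length vs = n"
    using vs length_finite_permutations_of_set by fastforce
  have "represented P R ?W S j"
    if j: "j \<in> {1..?T}" and i: "vs ! ((j - 1) mod n) \<in> S" for j
  proof -
    let ?i = "vs ! ((j - 1) mod n)"
    have "P j ?i \<in> permutations_of_set C" "R j ?i \<ge> 1"
      using P R S i j by (auto simp: profiles_def rank_matrices_def PiE_iff subset_iff)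
    \<comment> \<open>Ranks start at 1, so every set of top choices contains the first
      choice.\<close>
    then have "hd (P j ?i) \<in> top_choices P j ?i (R j ?i)"
      using assms(2) unfolding top_choices_def
      by (cases "P j ?i"; cases "R j ?i") (auto simp: permutations_of_set_def)
    then show ?thesis
      using i j len by (auto simp: represented_def serial_dictatorship_def)
  qed
  then have "card {j \<in> {1..?T}. vs ! ((j - 1) mod n) \<in> S}
      \<le> card {j \<in> {1..?T}. represented P R ?W S j}"
    by (intro card_mono) auto
  moreover have "k \<le> ?T"
    unfolding k by (rule order_trans[OF card_mono[of "{1..?T}"]]) auto
  ultimately show "int (card {j \<in> {1..?T}. represented P R ?W S j})
      \<ge> \<lfloor>real k * real (card S) / real n\<rfloor> - \<lfloor>real s * (real n - real s) / real n\<rfloor>"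
    using card_cyclic_rounds_ge[OF vs S assms(5), of q]
      partial_cycle_loss[OF assms(5), of k q "card S"] by linarith
qed

section \<open>Lower bound: pigeonhole and the cyclic profile\<close>

text \<open>Call an element light if its value is at most \<open>q\<close>. With at least
  \<open>n - s\<close> light elements, any \<open>n - s\<close> of them will do. Otherwise
  \<open>D\<close> takes in all of them, so the \<open>s\<close> elements left out have value at
  least \<open>q + 1\<close> each, which leaves at most \<open>q * n + s - s * (q + 1)\<close> for
  \<open>D\<close>.\<close>

lemma exists_light_subset:
  fixes f :: "'a \<Rightarrow> nat"
  assumes "finite A" and "card A = n" and "sum f A = q * n + s" and "s \<le> n"
  shows "\<exists>D\<subseteq>A. card D = n - s \<and> sum f D \<le> q * (n - s)"
proof -
  define B where "B = {x \<in> A. f x \<le> q}"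
  have B: "B \<subseteq> A" "finite B" using assms(1) by (auto simp: B_def)
  show ?thesis
  proof (cases "card B \<ge> n - s")
    case True
    then obtain D where D: "D \<subseteq> B" "card D = n - s"
      by (metis obtain_subset_with_card_n)
    have "sum f D \<le> of_nat (card D) * q"
      using D(1) by (intro sum_bounded_above) (auto simp: B_def)
    then show ?thesis using D B by (intro exI[of _ D]) (auto simp: mult.commute)
  next
    case False
    then obtain D where D: "B \<subseteq> D" "D \<subseteq> A" "card D = n - s"
      using exists_subset_between[of B "n - s" A] B assms by auto
    have "card (A - D) = s"
      using D assms by (simp add: card_Diff_subset finite_subset)
    moreover have "of_nat (card (A - D)) * (q + 1) \<le> sum f (A - D)"
      using D(1) by (intro sum_bounded_below) (force simp: B_def)
    moreover have "sum f A = sum f D + sum f (A - D)"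
      using D assms(1) by (simp add: sum.subset_diff)
    ultimately have "sum f D + s * (q + 1) \<le> q * n + s"
      using assms(3) by simp
    then have "sum f D \<le> q * (n - s)"
      using assms(4) by (simp add: algebra_simps diff_mult_distrib2)
    then show ?thesis using D by blast
  qed
qed

text \<open>The Condorcet cycle, repeated in every round. Voters and candidates share the indices
  \<open>{1..n}\<close>, so a set of candidates can be reread as a group.\<close>

definition cyclic_profile :: "nat \<Rightarrow> nat \<Rightarrow> nat profile" where
  "cyclic_profile n T = (\<lambda>j\<in>{1..T}. \<lambda>i\<in>{1..n}. rotate (i - 1) [1..<n + 1])"

lemma cyclic_profile_in_profiles: "cyclic_profile n T \<in> profiles n {1..n} T"
  by (auto simp: cyclic_profile_def profiles_def permutations_of_set_def)

lemma static_cyclic_profile: "static_profile T (cyclic_profile n T)"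
  by (simp add: static_profile_def cyclic_profile_def)

lemma top_choices_cyclic_profile:
  assumes "j \<in> {1..T}" and "i \<in> {1..n}" and "r \<le> n"
  shows "top_choices (cyclic_profile n T) j i r = (\<lambda>p. (i - 1 + p) mod n + 1) ` {..<r}"
proof -
  have "take r (rotate (i - 1) [1..<n + 1]) = map (\<lambda>p. (i - 1 + p) mod n + 1) [0..<r]"
    using assms by (intro nth_equalityI) (auto simp: nth_rotate simp del: upt_Suc)
  then show ?thesis
    using assms by (simp add: top_choices_def cyclic_profile_def atLeast0LessThan)
qed

text \<open>
  The number of candidates that voter \<open>i\<close> ranks above \<open>w\<close> in the cyclic profile; junk (\<open>n\<close>) for \<open>i = w\<close>.
\<close>

definition rank_above :: "nat \<Rightarrow> nat \<Rightarrow> nat \<Rightarrow> nat" where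
  "rank_above n w i = (if i < w then w - i else w + n - i)"

lemma rank_above_bounds:
  assumes "i \<in> {1..n}" and "w \<in> {1..n}" and "i \<noteq> w"
  shows "rank_above n w i \<in> {1..n}"
  using assms by (auto simp: rank_above_def)

text \<open>Counted from 0, \<open>w\<close> stands at position \<open>rank_above n w i\<close> in
  the ranking of voter \<open>i\<close>, just past the prefix taken.\<close>

lemma not_in_top_rank_above:
  assumes "j \<in> {1..T}" and "i \<in> {1..n}" and "w \<in> {1..n}" and "i \<noteq> w"
  shows "w \<notin> top_choices (cyclic_profile n T) j i (rank_above n w i)"
proof
  assume "w \<in> top_choices (cyclic_profile n T) j i (rank_above n w i)"
  then obtain p where p: "p < rank_above n w i" "w = (i - 1 + p) mod n + 1"
    using top_choices_cyclic_profile[OF assms(1,2), of "rank_above n w i"]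
      rank_above_bounds[OF assms(2-4)] by auto
  \<comment> \<open>Without wrap-around \<open>w = i + p\<close>, with it
    \<open>w = i + p - n\<close>; either way \<open>p\<close> equals
    \<open>rank_above n w i\<close>.\<close>
  show False
  proof (cases "i - 1 + p < n")
    case True
    then show ?thesis using p assms by (auto simp: rank_above_def split: if_splits)
  next
    case False
    moreover have "i - 1 + p - n < n"
      using p(1) assms by (auto simp: rank_above_def split: if_splits)
    ultimately have "(i - 1 + p) mod n = i - 1 + p - n"
      by (simp add: le_mod_geq)
    then show ?thesis using p False assms by (auto simp: rank_above_def split: if_splits)
  qed
qed

text \<open>The last entry of the prefix is the cyclic predecessor of \<open>w\<close>:
  \<open>w - 1\<close>, or \<open>n\<close> if \<open>w = 1\<close>. It does not depend on
  \<open>i\<close>, so the prefixes of all voters other than \<open>w\<close> share it.\<close>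

lemma predecessor_in_top_rank_above:
  assumes "j \<in> {1..T}" and "i \<in> {1..n}" and "w \<in> {1..n}" and "i \<noteq> w"
  shows "(w + n - 2) mod n + 1 \<in> top_choices (cyclic_profile n T) j i (rank_above n w i)"
proof -
  have b: "rank_above n w i \<in> {1..n}" by (rule rank_above_bounds[OF assms(2-4)])
  have "(i - 1 + (rank_above n w i - 1)) mod n = (w + n - 2) mod n"
  proof (cases "i < w")
    case True
    then have "i - 1 + (rank_above n w i - 1) = w - 2" "w + n - 2 = w - 2 + n"
      using assms by (auto simp: rank_above_def)
    then show ?thesis by simp
  next
    case False
    then have "i - 1 + (rank_above n w i - 1) = w + n - 2"
      using assms by (auto simp: rank_above_def)
    then show ?thesis by simp
  qed
  moreover have "rank_above n w i - 1 < rank_above n w i" using b by auto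
  ultimately show ?thesis
    using b by (subst top_choices_cyclic_profile[OF assms(1,2)])
      (auto simp: image_iff intro!: bexI[of _ "rank_above n w i - 1"])
qed

text \<open>The ranks may be chosen after \<open>W\<close> is known, which lets one fixed profile
  defeat every sequence.\<close>

lemma cyclic_profile_avoiding_ranks:
  assumes W: "W \<in> sequences {1..n} T" and S: "S \<subseteq> {1..n}"
  shows "\<exists>R\<in>rank_matrices n {1..n} T.
    \<forall>j\<in>{1..T}. agrees (cyclic_profile n T) R S j \<and>
      (represented (cyclic_profile n T) R W S j \<longrightarrow> W j \<in> S)"
proof
  let ?P = "cyclic_profile n T"
  \<comment> \<open>If the winner lies in \<open>S\<close>, the round is conceded: rank
    \<open>n\<close> makes every candidate a common choice. For voters outside \<open>S\<close>,
    \<open>n\<close> is a filler value.\<close>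
  define R where "R = (\<lambda>j\<in>{1..T}. \<lambda>i\<in>{1..n}.
    if W j \<in> S \<or> i \<notin> S then n else rank_above n (W j) i)"
  have Wj: "W j \<in> {1..n}" if "j \<in> {1..T}" for j
    using W that by (auto simp: sequences_def PiE_iff)
  show "R \<in> rank_matrices n {1..n} T"
    unfolding R_def rank_matrices_def card_atLeastAtMost
    using Wj rank_above_bounds by (intro restrict_PiE_iff[THEN iffD2] ballI) auto
  show "\<forall>j\<in>{1..T}. agrees ?P R S j \<and> (represented ?P R W S j \<longrightarrow> W j \<in> S)"
  proof
    fix j assume j: "j \<in> {1..T}"
    show "agrees ?P R S j \<and> (represented ?P R W S j \<longrightarrow> W j \<in> S)"
    proof (cases "W j \<in> S")
      case True
      have "W j \<in> top_choices ?P j i (R j i)" if "i \<in> S" for i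
      proof -
        have "i \<in> {1..n}" using that S by auto
        then have "R j i = n" "?P j i \<in> permutations_of_set {1..n}"
          using True j cyclic_profile_in_profiles[of n T]
          by (auto simp: R_def profiles_def PiE_iff)
        moreover from this have "length (?P j i) = n" "set (?P j i) = {1..n}"
          using length_finite_permutations_of_set permutations_of_setD(1) by fastforce+
        ultimately show ?thesis
          using Wj[OF j] by (simp add: top_choices_def)
      qed
      then show ?thesis using True by (auto simp: agrees_def)
    next
      case False
      have R: "R j i = rank_above n (W j) i" if "i \<in> S" for i
        using that S False j by (auto simp: R_def)
      have "(W j + n - 2) mod n + 1 \<in> top_choices ?P j i (R j i)"
        and "W j \<notin> top_choices ?P j i (R j i)" if "i \<in> S" for i
      proof -
        have "i \<in> {1..n}" "i \<noteq> W j" using that S False by auto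
        then show "(W j + n - 2) mod n + 1 \<in> top_choices ?P j i (R j i)"
          and "W j \<notin> top_choices ?P j i (R j i)"
          unfolding R[OF that]
          by (intro predecessor_in_top_rank_above not_in_top_rank_above j Wj; simp)+
      qed
      then show ?thesis by (auto simp: agrees_def represented_def)
    qed
  qed
qed

lemma cyclic_profile_not_all_rank_wPJR:
  assumes "s < n" and W: "W \<in> sequences {1..n} (q * n + s)"
    and L: "0 \<le> L" "L < \<lfloor>real s * (real n - real s) / real n\<rfloor>"
  shows "\<not> all_rank_wPJR n {1..n} (q * n + s) (cyclic_profile n (q * n + s)) W L"
proof
  let ?T = "q * n + s"
  let ?P = "cyclic_profile n ?T"
  assume wPJR: "all_rank_wPJR n {1..n} ?T ?P W L"
  define f where "f c = card {j \<in> {1..?T}. W j = c}" for c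
  have count: "sum f D = card {j \<in> {1..?T}. W j \<in> D}" if "finite D" for D
  proof -
    have *: "{j \<in> {1..?T}. W j \<in> D} = (\<Union>c\<in>D. {j \<in> {1..?T}. W j = c})" by auto
    show ?thesis
      unfolding f_def * using that by (intro card_UN_disjoint[symmetric]) auto
  qed
  have "{j \<in> {1..?T}. W j \<in> {1..n}} = {1..?T}"
    using W by (auto simp: sequences_def PiE_iff)
  then have "sum f {1..n} = ?T" using count[of "{1..n}"] by simp
  then obtain S where S: "S \<subseteq> {1..n}" "card S = n - s" "sum f S \<le> q * (n - s)"
    using exists_light_subset[of "{1..n}" n f q s] assms(1) by auto
  then have "finite S" "S \<noteq> {}" using assms(1) by (auto intro: finite_subset)
  then have "group n S" using S by (simp add: group_def)
  obtain R where R: "R \<in> rank_matrices n {1..n} ?T"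
    and agr: "\<forall>j\<in>{1..?T}. agrees ?P R S j"
    and rep: "\<And>j. j \<in> {1..?T} \<Longrightarrow> represented ?P R W S j \<Longrightarrow> W j \<in> S"
    using cyclic_profile_avoiding_ranks[OF W S(1)] by blast
  have "card {j \<in> {1..?T}. represented ?P R W S j} \<le> card {j \<in> {1..?T}. W j \<in> S}"
    using rep by (intro card_mono) auto
  also have "\<dots> \<le> q * (n - s)" using S count[OF \<open>finite S\<close>] by simp
  finally have "int (card {j \<in> {1..?T}. represented ?P R W S j}) \<le> int (q * (n - s))"
    by (simp only: of_nat_le_iff)
  moreover have "\<lfloor>real ?T * real (card S) / real n\<rfloor> - L
      \<le> int (card {j \<in> {1..?T}. represented ?P R W S j})"
    using wPJR R \<open>group n S\<close> agr unfolding all_rank_wPJR_def by blast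
  ultimately have "\<lfloor>real ?T * real (card S) / real n\<rfloor> - L \<le> int (q * (n - s))"
    by (rule order_trans[rotated])
  \<comment> \<open>At size \<open>n - s\<close> the entitlement exceeds the integer
    \<open>q * (n - s)\<close> by exactly \<open>s * (n - s) / n\<close>.\<close>
  moreover have "real ?T * real (card S) / real n
      = real s * (real n - real s) / real n + real_of_int (int (q * (n - s)))"
    using assms(1) S(2) by (simp add: of_nat_diff field_simps)
  then have "\<lfloor>real ?T * real (card S) / real n\<rfloor>
      = \<lfloor>real s * (real n - real s) / real n\<rfloor> + int (q * (n - s))"
    by (simp only: floor_add_int)
  ultimately show False using L(2) by linarith
qed

theorem theorem4p12:
  fixes n T q s :: nat
  assumes "n \<ge> 1" and "T \<ge> 1" and "T = q * n + s" and "s < n"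
  shows
    "(\<forall>(C :: 'c set) vs.
        finite C \<and> C \<noteq> {} \<and> vs \<in> permutations_of_set {1..n} \<longrightarrow>
        online_rule n C (serial_dictatorship vs) \<and>
        (\<forall>P\<in>profiles n C T.
           all_rank_PJR n C T P (serial_dictatorship vs T P)
             \<lfloor>real s * (real n - real s) / real n\<rfloor>))
   \<and> (\<forall>L :: int. 0 \<le> L \<and> L < \<lfloor>real s * (real n - real s) / real n\<rfloor> \<longrightarrow>
        \<not> (\<exists>F :: nat rule. offline_rule n {1..n} F \<and>
             (\<forall>P\<in>profiles n {1..n} T. all_rank_wPJR n {1..n} T P (F T P) L)))
   \<and> (\<exists>P\<in>profiles n {1..n :: nat} T. static_profile T P \<and>
        (\<forall>L :: int. 0 \<le> L \<and> L < \<lfloor>real s * (real n - real s) / real n\<rfloor> \<longrightarrow>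
           (\<forall>W\<in>sequences {1..n} T. \<not> all_rank_wPJR n {1..n} T P W L)))"
proof (intro conjI)
  note T = assms(3)
  show "\<forall>(C :: 'c set) vs.
      finite C \<and> C \<noteq> {} \<and> vs \<in> permutations_of_set {1..n} \<longrightarrow>
      online_rule n C (serial_dictatorship vs) \<and>
      (\<forall>P\<in>profiles n C T.
         all_rank_PJR n C T P (serial_dictatorship vs T P)
           \<lfloor>real s * (real n - real s) / real n\<rfloor>)"
    unfolding T
    by (intro allI impI conjI ballI serial_dictatorship_online
        serial_dictatorship_all_rank_PJR assms(1,4)) auto
  \<comment> \<open>Any rule must output some sequence on the cyclic profile, and every sequence
    fails there.\<close>
  show "\<forall>L :: int. 0 \<le> L \<and> L < \<lfloor>real s * (real n - real s) / real n\<rfloor> \<longrightarrow>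
      \<not> (\<exists>F :: nat rule. offline_rule n {1..n} F \<and>
           (\<forall>P\<in>profiles n {1..n} T. all_rank_wPJR n {1..n} T P (F T P) L))"
    unfolding T offline_rule_def
    using cyclic_profile_not_all_rank_wPJR[OF assms(4), of _ q]
      cyclic_profile_in_profiles[of n "q * n + s"]
    by metis
  show "\<exists>P\<in>profiles n {1..n :: nat} T. static_profile T P \<and>
      (\<forall>L :: int. 0 \<le> L \<and> L < \<lfloor>real s * (real n - real s) / real n\<rfloor> \<longrightarrow>
         (\<forall>W\<in>sequences {1..n} T. \<not> all_rank_wPJR n {1..n} T P W L))"
    unfolding T
    by (intro bexI[OF _ cyclic_profile_in_profiles] conjI static_cyclic_profile allI impI ballI
        cyclic_profile_not_all_rank_wPJR[OF assms(4)]) simp_all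
qed

end
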